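(* Let $(\varepsilon_n)_{n \geq 0}$ be the regular $\pm 1$ paperfolding sequence and let $b$ be a positive real number. Then $$\prod_{n \geq 0} \left( \frac{n+b}{n + \frac{1+b}{2}} \right)^{\varepsilon_n} = \frac{\Gamma(\frac{1}{4})^2}{\pi \sqrt{2}} \times \frac{\Gamma(\frac{1}{2} + \frac{b}{4})}{\Gamma(\frac{b}{4})} = 2^{\frac{1-b}{2}} \left(\frac{\Gamma(\frac{1}{4})}{\Gamma(\frac{b}{4})}\right)^2 \times \frac{\Gamma(\frac{b}{2})}{\sqrt{\pi}},$$ where $\Gamma$ is Euler's gamma function.
   Context: The regular $\pm 1$ paperfolding sequence $(\varepsilon_n)_{n \geq 0}$ is defined by $\varepsilon_{2n} = (-1)^n$ and $\varepsilon_{2n+1} = \varepsilon_n$ for all $n \geq 0$. *)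

theory Defs
  imports "HOL-Analysis.Analysis"
begin

function paperfolding :: "nat \<Rightarrow> int" where
  "paperfolding n = (if even n then (-1) ^ (n div 2) else paperfolding (n div 2))"
  by auto
termination
  by (relation "Wellfounded.measure id") (auto elim!: oddE)

declare paperfolding.simps [simp del]

lemma paperfolding_even: "paperfolding (2 * n) = (-1) ^ n"
  by (subst paperfolding.simps) simp

lemma paperfolding_odd: "paperfolding (2 * n + 1) = paperfolding n"
  by (subst paperfolding.simps) simp

end

theory Submission
  imports Defs "HOL-Real_Asymp.Real_Asymp"
begin

text \<open>
  Put \<open>D b = (\<Sum>n. \<epsilon>\<^sub>n ln ((n + b) / (n + 1)))\<close>. This series converges for \<open>b > 0\<close> by partial
  summation, since the partial sums of \<open>\<epsilon>\<close> grow only logarithmically. The logarithm of the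
  product is \<open>D b - D ((1 + b) / 2)\<close>. Splitting \<open>D b\<close> into even and odd indices, the odd part is
  exactly \<open>D ((1 + b) / 2)\<close>, so what remains is the even part
  \<open>(\<Sum>n. (-1)\<^sup>n ln ((2n + b) / (2n + 1)))\<close>, which is evaluated by Euler's limit formula for
  \<open>\<Gamma>\<close>. The closed forms then agree by Legendre's duplication formula.
\<close>

section \<open>Growth of the partial sums of the paperfolding sequence\<close>

lemma sum_lessThan_double:
  fixes f :: "nat \<Rightarrow> 'a::comm_monoid_add"
  shows "(\<Sum>k<2*n. f k) = (\<Sum>k<n. f (2*k)) + (\<Sum>k<n. f (2*k+1))"
  by (induction n) (simp_all add: ac_simps)

lemma sum_alternating_signs:
  "(\<Sum>k<n. (-1) ^ k :: int) = (if even n then 0 else 1)"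
  by (induction n) auto

lemma sum_paperfolding_double:
  "(\<Sum>k<2*n. paperfolding k) = (\<Sum>k<n. paperfolding k) + (if even n then 0 else 1)"
  unfolding sum_lessThan_double paperfolding_even paperfolding_odd sum_alternating_signs by simp

lemma sum_paperfolding_double_Suc:
  "(\<Sum>k<2*n+1. paperfolding k) = (\<Sum>k<n. paperfolding k) + (if even n then 1 else 0)"
proof -
  have "(\<Sum>k<2*n+1. paperfolding k) = (\<Sum>k<2*n. paperfolding k) + paperfolding (2*n)"
    by simp
  then show ?thesis
    unfolding sum_paperfolding_double paperfolding_even by simp
qed

text \<open>Among the first \<open>n\<close> terms, the odd-indexed ones reproduce the first
  \<open>n div 2\<close> terms, while the even-indexed ones alternate in sign from 1 on and so add
  up to 0 or 1.\<close>

lemma sum_paperfolding_div2: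
  "(\<Sum>k<n. paperfolding k) - (\<Sum>k<n div 2. paperfolding k) \<in> {0, 1}"
proof (cases "even n")
  case True
  then obtain m where "n = 2 * m" by blast
  then show ?thesis using sum_paperfolding_double[of m] by simp
next
  case False
  then obtain m where "n = 2 * m + 1" by (rule oddE)
  then show ?thesis using sum_paperfolding_double_Suc[of m] by simp
qed

text \<open>Each halving of \<open>n\<close> lowers the sum by at most 1 and \<open>log 2 n\<close>
  by at least 1; at \<open>n = 1\<close> the upper bound is attained.\<close>

lemma sum_paperfolding_bounds:
  assumes "n > 0"
  shows "0 \<le> (\<Sum>k<n. paperfolding k)"
    and "of_int (\<Sum>k<n. paperfolding k) \<le> 1 + log 2 (real n)"
proof -
  have "0 \<le> (\<Sum>k<n. paperfolding k) \<and> of_int (\<Sum>k<n. paperfolding k) \<le> 1 + log 2 (real n)"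
    using assms
  proof (induction n rule: less_induct)
    case (less n)
    show ?case
    proof (cases "n = 1")
      case True
      then show ?thesis by (simp add: paperfolding.simps)
    next
      case False
      with less.prems have n: "n \<ge> 2" by simp
      then have IH: "0 \<le> (\<Sum>k<n div 2. paperfolding k)"
        "of_int (\<Sum>k<n div 2. paperfolding k) \<le> 1 + log 2 (real (n div 2))"
        using less.IH[of "n div 2"] by auto
      have "real (n div 2) \<le> real n / 2"
        by linarith
      then have "log 2 (real (n div 2)) \<le> log 2 (real n / 2)"
        using n by (intro log_mono) auto
      also have "\<dots> = log 2 (real n) - 1"
        using n by (simp add: log_divide)
      finally have "of_int (\<Sum>k<n div 2. paperfolding k) + 1 \<le> 1 + log 2 (real n)"
        using IH(2) by linarith
      moreover have "(\<Sum>k<n. paperfolding k) = (\<Sum>k<n div 2. paperfolding k) \<or>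
          (\<Sum>k<n. paperfolding k) = (\<Sum>k<n div 2. paperfolding k) + 1"
        using sum_paperfolding_div2[of n] by auto
      ultimately show ?thesis using IH(1) by (elim disjE) (simp_all del: of_int_sum)
    qed
  qed
  then show "0 \<le> (\<Sum>k<n. paperfolding k)"
    and "of_int (\<Sum>k<n. paperfolding k) \<le> 1 + log 2 (real n)" by auto
qed

lemma sum_paperfolding_bigo:
  "(\<lambda>n. \<Sum>k<n. of_int (paperfolding k)) \<in> O(\<lambda>n. ln (real n))"
proof -
  have "(\<lambda>n. \<Sum>k<n. of_int (paperfolding k)) \<in> O(\<lambda>n. 1 + log 2 (real n))"
  proof (rule landau_o.big_mono, use eventually_gt_at_top[of 0] in eventually_elim)
    case (elim n)
    then show ?case
      using sum_paperfolding_bounds[of n] by (simp flip: of_int_sum)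
  qed
  also have "(\<lambda>n. 1 + log 2 (real n)) \<in> O(\<lambda>n. ln (real n))"
    by real_asymp
  finally show ?thesis .
qed

section \<open>Convergence of the logarithmic series\<close>

lemma sum_by_parts:
  fixes e a :: "nat \<Rightarrow> 'a::comm_ring"
  shows "(\<Sum>n<N. e n * a n) =
    (\<Sum>k<N. e k) * a N + (\<Sum>n<N. (\<Sum>k<Suc n. e k) * (a n - a (Suc n)))"
  by (induction N) (simp_all add: algebra_simps)

text \<open>Dividing by \<open>n + 1\<close> makes the logarithms \<open>O(1/n)\<close>, with
  consecutive differences \<open>O(1/n^2)\<close>. Against logarithmic partial sums of the signs,
  the boundary term of the summation by parts vanishes and the remaining series converges.\<close>

lemma summable_paperfolding_ln:
  fixes b :: real
  assumes "b > 0"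
  shows "summable (\<lambda>n. of_int (paperfolding n) * ln ((real n + b) / (real n + 1)))"
proof -
  define e where "e n = (of_int (paperfolding n) :: real)" for n
  define a where "a n = ln ((real n + b) / (real n + 1))" for n
  have e: "(\<lambda>n. \<Sum>k<n. e k) \<in> O(\<lambda>n. ln (real n))"
    unfolding e_def by (rule sum_paperfolding_bigo)
  have a: "a \<in> O(\<lambda>n. 1 / real n)"
    unfolding a_def by real_asymp
  have diff: "(\<lambda>n. a n - a (Suc n)) \<in> O(\<lambda>n. 1 / real n ^ 2)"
    unfolding a_def by real_asymp
  have "(\<lambda>n. (\<Sum>k<n. e k) * a n) \<in> O(\<lambda>n. ln (real n) * (1 / real n))"
    by (intro landau_o.big.mult e a)
  also have "(\<lambda>n. ln (real n) * (1 / real n)) \<in> o(\<lambda>_. 1)"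
    by real_asymp
  finally have lim: "(\<lambda>n. (\<Sum>k<n. e k) * a n) \<longlonglongrightarrow> 0"
    using smalloD_tendsto by fastforce
  have "(\<lambda>n. \<Sum>k<Suc n. e k) \<in> O(\<lambda>n. ln (real (Suc n)))"
    using landau_o.big.compose[OF e filterlim_Suc] .
  then have "(\<lambda>n. (\<Sum>k<Suc n. e k) * (a n - a (Suc n))) \<in>
      O(\<lambda>n. ln (real (Suc n)) * (1 / real n ^ 2))"
    by (intro landau_o.big.mult diff)
  \<comment> \<open>Any exponent strictly between -2 and -1 would do: it absorbs the logarithm and
    still gives a summable majorant.\<close>
  also have "(\<lambda>n. ln (real (Suc n)) * (1 / real n ^ 2)) \<in> O(\<lambda>n. real n powr (-3/2))"
    by real_asymp
  finally have "summable (\<lambda>n. (\<Sum>k<Suc n. e k) * (a n - a (Suc n)))"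
    by (rule summable_comparison_test_bigo [rotated]) (simp add: summable_real_powr_iff)
  from tendsto_add[OF lim summable_LIMSEQ[OF this]]
  have "(\<lambda>n. e n * a n) sums (0 + (\<Sum>n. (\<Sum>k<Suc n. e k) * (a n - a (Suc n))))"
    unfolding sums_def sum_by_parts[of e a] .
  then show ?thesis
    unfolding e_def a_def by (rule sums_summable)
qed

section \<open>Limits and identities for the Gamma function\<close>

text \<open>In the quotient of Euler's approximants the factorials cancel, and
  \<open>x + y = u + v\<close> makes the powers of \<open>n\<close> cancel as well. Only the
  Pochhammer symbols survive, and these are the finite products.\<close>

lemma Gamma_quotient_LIMSEQ:
  fixes x y u v :: real
  assumes "x > 0" "y > 0" "u > 0" "v > 0" and eq: "x + y = u + v"
  shows "(\<lambda>n. \<Prod>k<n. (real k + x) * (real k + y) / ((real k + u) * (real k + v)))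
    \<longlonglongrightarrow> Gamma u * Gamma v / (Gamma x * Gamma y)"
proof (rule Lim_transform_eventually)
  have "Gamma x > 0" "Gamma y > 0"
    using assms by (auto intro: Gamma_real_pos)
  then have "Gamma x * Gamma y \<noteq> 0"
    by auto
  then show "(\<lambda>n. Gamma_series' u n * Gamma_series' v n / (Gamma_series' x n * Gamma_series' y n))
    \<longlonglongrightarrow> Gamma u * Gamma v / (Gamma x * Gamma y)"
    by (intro tendsto_intros Gamma_series'_LIMSEQ)
  show "\<forall>\<^sub>F n in sequentially.
    Gamma_series' u n * Gamma_series' v n / (Gamma_series' x n * Gamma_series' y n) =
      (\<Prod>k<n. (real k + x) * (real k + y) / ((real k + u) * (real k + v)))"
  proof (intro always_eventually allI)
    fix n :: nat
    have exp_eq: "exp (u * ln (real n)) * exp (v * ln (real n)) =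
        exp (x * ln (real n)) * exp (y * ln (real n))"
      by (simp flip: exp_add distrib_right add: eq)
    have pos: "pochhammer x n > 0" "pochhammer y n > 0" "pochhammer u n > 0" "pochhammer v n > 0"
      using assms by (auto intro: pochhammer_pos)
    have "Gamma_series' u n * Gamma_series' v n / (Gamma_series' x n * Gamma_series' y n) =
      (exp (u * ln (real n)) * exp (v * ln (real n))) /
      (exp (x * ln (real n)) * exp (y * ln (real n))) *
      (pochhammer x n * pochhammer y n / (pochhammer u n * pochhammer v n))"
      using pos by (simp add: Gamma_series'_def field_simps)
    also have "\<dots> = pochhammer x n * pochhammer y n / (pochhammer u n * pochhammer v n)"
      unfolding exp_eq by simp
    also have "\<dots> = (\<Prod>k<n. (real k + x) * (real k + y) / ((real k + u) * (real k + v)))"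
      by (simp add: pochhammer_prod prod.distrib prod_dividef add.commute atLeast0LessThan)
    finally show "Gamma_series' u n * Gamma_series' v n / (Gamma_series' x n * Gamma_series' y n) =
      (\<Prod>k<n. (real k + x) * (real k + y) / ((real k + u) * (real k + v)))" .
  qed
qed

text \<open>Restriction of the complex formula to the positive axis, which avoids the poles.\<close>

lemma Gamma_legendre_duplication_real:
  fixes x :: real
  assumes "x > 0"
  shows "Gamma x * Gamma (x + 1/2) = 2 powr (1 - 2 * x) * sqrt pi * Gamma (2 * x)"
proof -
  have "complex_of_real x \<notin> \<int>\<^sub>\<le>\<^sub>0" "complex_of_real (x + 1/2) \<notin> \<int>\<^sub>\<le>\<^sub>0"
    using assms by (auto simp del: of_real_add elim!: nonpos_Ints_cases simp: complex_eq_iff)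
  then have "Gamma (complex_of_real x) * Gamma (complex_of_real (x + 1/2)) =
      complex_of_real (exp ((1 - 2 * x) * ln 2) * sqrt pi) * Gamma (complex_of_real (2 * x))"
    using Gamma_legendre_duplication[of "complex_of_real x"]
      exp_of_real[of "(1 - 2 * x) * ln 2", where 'a = complex] by simp
  then have "complex_of_real (Gamma x * Gamma (x + 1/2)) =
      complex_of_real (exp ((1 - 2 * x) * ln 2) * sqrt pi * Gamma (2 * x))"
    unfolding Gamma_complex_of_real by simp
  then show ?thesis
    unfolding of_real_eq_iff by (simp add: powr_def)
qed

text \<open>Duplication at 1/4, where \<open>Gamma (1/2)\<close> contributes a second factor
  \<open>sqrt pi\<close>.\<close>

lemma Gamma_quarter_mult_three_quarters: "Gamma (1/4) * Gamma (3/4 :: real) = pi * sqrt 2"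
  using Gamma_legendre_duplication_real[of "1/4"] by (simp add: Gamma_one_half_real powr_half_sqrt)

section \<open>Evaluation of the product\<close>

lemma suminf_paperfolding_ln_diff:
  fixes b :: real
  assumes "b > 0"
  defines "D \<equiv> (\<lambda>x. \<Sum>n. of_int (paperfolding n) * ln ((real n + x) / (real n + 1)))"
  shows "exp (D b - D ((1 + b) / 2)) =
    Gamma (1/4) ^ 2 / (pi * sqrt 2) * (Gamma (1/2 + b/4) / Gamma (b/4))"
proof -
  define t where "t x n = of_int (paperfolding n) * ln ((real n + x) / (real n + 1))" for x n
  define c where "c = (1 + b) / 2"
  \<comment> \<open>Two consecutive terms of the even part have opposite signs and combine into
    \<open>ln (r k)\<close>, once 4 is taken out of each of the four linear factors.\<close>
  define r where "r k = (real k + b/4) * (real k + 3/4) / ((real k + 1/4) * (real k + (1/2 + b/4)))"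
    for k
  have "c > 0" using assms by (simp add: c_def)
  have D: "(\<lambda>N. \<Sum>n<N. t x n) \<longlonglongrightarrow> D x" if "x > 0" for x
    unfolding D_def t_def by (intro summable_LIMSEQ summable_paperfolding_ln that)
  have odd_terms: "t b (2*n+1) = t c n" for n
  proof -
    have "(real (2*n+1) + b) / (real (2*n+1) + 1) = (real n + c) / (real n + 1)"
      by (simp add: c_def field_simps)
    then show ?thesis unfolding t_def paperfolding_odd by simp
  qed
  have even_terms: "t b (2*(2*k)) + t b (2*(2*k+1)) = ln (r k)" for k
  proof -
    have "t b (2*(2*k)) + t b (2*(2*k+1)) =
        ln ((4 * real k + b) / (4 * real k + 1)) - ln ((4 * real k + 2 + b) / (4 * real k + 3))"
      unfolding t_def paperfolding_even by (simp add: algebra_simps)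
    also have "\<dots> = ln (((4 * real k + b) / (4 * real k + 1)) / ((4 * real k + 2 + b) / (4 * real k + 3)))"
      using assms by (intro ln_divide_pos [symmetric]) (auto intro!: divide_pos_pos add_nonneg_pos)
    also have "((4 * real k + b) / (4 * real k + 1)) / ((4 * real k + 2 + b) / (4 * real k + 3)) = r k"
    proof -
      have "4 * real k + b = 4 * (real k + b/4)" "4 * real k + 1 = 4 * (real k + 1/4)"
        "4 * real k + 2 + b = 4 * (real k + (1/2 + b/4))" "4 * real k + 3 = 4 * (real k + 3/4)"
        by simp_all
      then show ?thesis
        unfolding r_def by (simp only: mult_divide_mult_cancel_left) simp
    qed
    finally show ?thesis .
  qed
  have r_pos: "r k > 0" for k
    unfolding r_def using assms by (auto intro!: divide_pos_pos mult_pos_pos add_nonneg_pos)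
  \<comment> \<open>With the two series cut at \<open>4N\<close> and \<open>2N\<close>, the
    odd-indexed terms of the first cancel the second exactly. The \<open>2N\<close> even-indexed
    terms left over group into pairs.\<close>
  have "exp ((\<Sum>n<2*(2*N). t b n) - (\<Sum>n<2*N. t c n)) = (\<Prod>k<N. r k)" for N
  proof -
    have "(\<Sum>n<2*(2*N). t b n) - (\<Sum>n<2*N. t c n) = (\<Sum>n<2*N. t b (2*n))"
      unfolding sum_lessThan_double[of "t b" "2*N"] odd_terms by simp
    also have "\<dots> = (\<Sum>k<N. ln (r k))"
      unfolding sum_lessThan_double[of "\<lambda>n. t b (2*n)" N] even_terms[symmetric] sum.distrib ..
    finally show ?thesis
      using r_pos by (simp add: exp_sum)
  qed
  moreover have "(\<lambda>N. exp ((\<Sum>n<2*(2*N). t b n) - (\<Sum>n<2*N. t c n))) \<longlonglongrightarrow> exp (D b - D c)"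
  proof (intro tendsto_intros)
    show "(\<lambda>N. \<Sum>n<2*(2*N). t b n) \<longlonglongrightarrow> D b"
      by (rule filterlim_compose[OF D[OF \<open>b > 0\<close>]]) real_asymp
    show "(\<lambda>N. \<Sum>n<2*N. t c n) \<longlonglongrightarrow> D c"
      by (rule filterlim_compose[OF D[OF \<open>c > 0\<close>]]) real_asymp
  qed
  moreover have "(\<lambda>N. \<Prod>k<N. r k) \<longlonglongrightarrow> Gamma (1/4) * Gamma (1/2 + b/4) / (Gamma (b/4) * Gamma (3/4))"
    unfolding r_def using assms by (intro Gamma_quotient_LIMSEQ) auto
  ultimately have "exp (D b - D c) = Gamma (1/4) * Gamma (1/2 + b/4) / (Gamma (b/4) * Gamma (3/4))"
    by (metis (no_types, lifting) LIMSEQ_unique ext)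
  \<comment> \<open>Expanding the fraction by \<open>Gamma (1/4)\<close> allows
    \<open>Gamma (3/4)\<close> to be eliminated.\<close>
  also have "\<dots> = Gamma (1/4) ^ 2 / (Gamma (1/4) * Gamma (3/4)) * (Gamma (1/2 + b/4) / Gamma (b/4))"
    using Gamma_real_pos[of "1/4"] by (simp add: power2_eq_square)
  finally show ?thesis
    unfolding Gamma_quarter_mult_three_quarters c_def .
qed

theorem theorem1:
  fixes b :: real
  assumes "b > 0"
  shows "(\<lambda>n::nat. ((real n + b) / (real n + (1 + b) / 2)) powi paperfolding n) has_prod
           (Gamma (1/4) ^ 2 / (pi * sqrt 2) * (Gamma (1/2 + b/4) / Gamma (b/4)))
       \<and> Gamma (1/4) ^ 2 / (pi * sqrt 2) * (Gamma (1/2 + b/4) / Gamma (b/4)) =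
           2 powr ((1 - b) / 2) * (Gamma (1/4) / Gamma (b/4)) ^ 2 * (Gamma (b/2) / sqrt pi)"
proof
  define c where "c = (1 + b) / 2"
  define t where "t x n = of_int (paperfolding n) * ln ((real n + x) / (real n + 1))" for x n
  have "c > 0" using assms by (simp add: c_def)
  have "(\<lambda>n. t b n - t c n) sums (suminf (t b) - suminf (t c))"
    unfolding t_def using assms \<open>c > 0\<close>
    by (intro sums_diff summable_sums summable_paperfolding_ln)
  \<comment> \<open>The first disjunct of \<open>has_prod_def\<close> is convergence to a nonzero
    limit from index 0 on, as befits a product of exponentials.\<close>
  then have "(\<lambda>n. exp (t b n - t c n)) has_prod exp (suminf (t b) - suminf (t c))"
    unfolding has_prod_def by (intro disjI1 sums_imp_has_prod_exp)
  moreover have "exp (t b n - t c n) = ((real n + b) / (real n + c)) powi paperfolding n" for n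
  proof -
    have pos: "real n + b > 0" "real n + c > 0" "real n + 1 > 0"
      using assms \<open>c > 0\<close> by auto
    then have "t b n - t c n = of_int (paperfolding n) * ln ((real n + b) / (real n + c))"
      unfolding t_def by (simp add: ln_div algebra_simps)
    then show ?thesis
      using pos by (simp add: powr_def flip: powr_real_of_int')
  qed
  moreover have "exp (suminf (t b) - suminf (t c)) =
      Gamma (1/4) ^ 2 / (pi * sqrt 2) * (Gamma (1/2 + b/4) / Gamma (b/4))"
    unfolding t_def[abs_def] c_def by (rule suminf_paperfolding_ln_diff[OF assms])
  ultimately show "(\<lambda>n::nat. ((real n + b) / (real n + (1 + b) / 2)) powi paperfolding n) has_prod
           (Gamma (1/4) ^ 2 / (pi * sqrt 2) * (Gamma (1/2 + b/4) / Gamma (b/4)))"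
    by (simp only: c_def)
next
  have pos: "Gamma (b/4) > 0"
    using assms by (intro Gamma_real_pos) auto
  \<comment> \<open>Duplication at \<open>b/4\<close> trades \<open>Gamma (1/2 + b/4)\<close> for
    \<open>Gamma (b/2)\<close> and a second \<open>Gamma (b/4)\<close> in the denominator.\<close>
  have "Gamma (b/4) * Gamma (1/2 + b/4) = 2 powr (1 - b/2) * sqrt pi * Gamma (b/2)"
    using Gamma_legendre_duplication_real[of "b/4"] assms by (simp add: add.commute)
  then have "Gamma (1/2 + b/4) = 2 powr (1 - b/2) * sqrt pi * Gamma (b/2) / Gamma (b/4)"
    using pos by (simp add: eq_divide_eq mult.commute)
  \<comment> \<open>Splitting the exponent as \<open>1/2 + (1 - b)/2\<close> isolates the
    \<open>sqrt 2\<close> that cancels the one beside \<open>pi\<close>.\<close>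
  moreover have "2 powr (1 - b/2) = sqrt 2 * 2 powr ((1 - b) / 2)"
    by (simp add: diff_divide_distrib flip: powr_half_sqrt powr_add)
  moreover have "pi = sqrt pi * sqrt pi" by simp
  ultimately show "Gamma (1/4) ^ 2 / (pi * sqrt 2) * (Gamma (1/2 + b/4) / Gamma (b/4)) =
           2 powr ((1 - b) / 2) * (Gamma (1/4) / Gamma (b/4)) ^ 2 * (Gamma (b/2) / sqrt pi)"
    using pos by (simp add: field_simps power2_eq_square)
qed

end
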